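(* Let $\lambda$ be a nonzero real number and let $(b_n(\lambda))_{n\ge0}$ be any sequence of real numbers. Define the degenerate A-algorithm matrix $(b_{n,m}(\lambda))_{n,m\ge0}$ by $b_{0,m}(\lambda)=b_m(\lambda)$ for $m\ge0$ and \[ b_{n,m}(\lambda)=(m+1)\Big(\Big(1-\frac{(n-1)\lambda}{m+1}\Big)b_{n-1,m}(\lambda)-b_{n-1,m+1}(\lambda)\Big),\qquad n\ge1,\ m\ge0. \] Then for every $n\ge0$, \[ b_{n,0}(\lambda)=\sum_{k=0}^{n}(-1)^{k}k!\Big({n+1 \brace k+1}_{\lambda}+n\lambda {n \brace k+1}_{\lambda}\Big)b_{0,k}(\lambda). \]
   Context: For $n\ge0$ set $(x)_{0,\lambda}=1$, $(x)_{n,\lambda}=x(x-\lambda)\cdots(x-(n-1)\lambda)$ for $n\ge1$, and $(x)_0=1$, $(x)_n=x(x-1)\cdots(x-n+1)$ for $n\ge1$. The degenerate Stirling numbers of the second kind ${n \brace k}_{\lambda}$ are defined by $(x)_{n,\lambda}=\sum_{k=0}^{n}{n \brace k}_{\lambda}(x)_{k}$ for $n\ge0$, with ${n \brace k}_\lambda=0$ for $k>n$. *)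

theory Defs
  imports Complex_Main
begin

definition deg_ffact :: "real \<Rightarrow> real \<Rightarrow> nat \<Rightarrow> real" where
  "deg_ffact lam x n = (\<Prod>i<n. x - real i * lam)"

definition ffact :: "real \<Rightarrow> nat \<Rightarrow> real" where
  "ffact x n = (\<Prod>i<n. x - real i)"

text \<open>The row \<open>n\<close> of the degenerate Stirling numbers of the second kind is the coefficient
  sequence, extended by zero, of the degenerate falling factorial with respect to the ordinary
  falling factorials.  Lemma \<open>ex1_deg_Stirling_row\<close> shows that the definite description is
  well defined.\<close>

definition deg_Stirling2 :: "real \<Rightarrow> nat \<Rightarrow> nat \<Rightarrow> real" where
  "deg_Stirling2 lam n =
     (THE S. (\<forall>x. deg_ffact lam x n = (\<Sum>k\<le>n. S k * ffact x k)) \<and> (\<forall>k>n. S k = 0))"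

lemma ex_deg_Stirling_row:
  "\<exists>S. (\<forall>x. deg_ffact lam x n = (\<Sum>k\<le>n. S k * ffact x k)) \<and> (\<forall>k>n. S k = 0)"
proof (induction n)
  case 0
  show ?case
    by (rule exI[of _ "\<lambda>k. if k = 0 then 1 else 0"]) (simp add: deg_ffact_def ffact_def)
next
  case (Suc n)
  then obtain S where S: "\<And>x. deg_ffact lam x n = (\<Sum>k\<le>n. S k * ffact x k)"
    and S0: "\<And>k. k > n \<Longrightarrow> S k = 0" by blast
  define T where
    "T k = (case k of 0 \<Rightarrow> 0 | Suc j \<Rightarrow> S j) + (real k - real n * lam) * S k" for k
  have "deg_ffact lam x (Suc n) = (\<Sum>k\<le>Suc n. T k * ffact x k)" for x
  proof -
    have "deg_ffact lam x (Suc n) = (x - real n * lam) * deg_ffact lam x n"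
      by (simp add: deg_ffact_def mult.commute)
    also have "\<dots> = (\<Sum>k\<le>n. S k * ffact x (Suc k) + (real k - real n * lam) * S k * ffact x k)"
      unfolding S sum_distrib_left
      by (rule sum.cong) (auto simp: ffact_def algebra_simps)
    also have "\<dots> = (\<Sum>k\<le>n. S k * ffact x (Suc k))
        + (\<Sum>k\<le>Suc n. (real k - real n * lam) * S k * ffact x k)"
      by (simp add: sum.distrib S0)
    also have "(\<Sum>k\<le>n. S k * ffact x (Suc k))
        = (\<Sum>k\<le>Suc n. (case k of 0 \<Rightarrow> 0 | Suc j \<Rightarrow> S j) * ffact x k)"
      by (simp add: sum.atMost_Suc_shift del: sum.atMost_Suc)
    finally show ?thesis
      by (simp only: T_def sum.distrib distrib_right)
  qed
  moreover have "T k = 0" if "k > Suc n" for k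
    using that S0 by (auto simp: T_def split: nat.splits)
  ultimately show ?case by blast
qed

lemma ex1_deg_Stirling_row:
  "\<exists>!S. (\<forall>x. deg_ffact lam x n = (\<Sum>k\<le>n. S k * ffact x k)) \<and> (\<forall>k>n. S k = 0)"
proof (rule ex_ex1I[OF ex_deg_Stirling_row])
  fix S T
  assume S: "(\<forall>x. deg_ffact lam x n = (\<Sum>k\<le>n. S k * ffact x k)) \<and> (\<forall>k>n. S k = 0)"
    and T: "(\<forall>x. deg_ffact lam x n = (\<Sum>k\<le>n. T k * ffact x k)) \<and> (\<forall>k>n. T k = 0)"
  have "S k = T k" for k
  proof (induction k rule: less_induct)
    case (less k)
    show ?case
    proof (cases "k \<le> n")
      case False
      then show ?thesis using S T by simp
    next
      case True
      have vanish: "ffact (real k) j = 0" if "j > k" for j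
        using that by (auto simp: ffact_def)
      have "(\<Sum>j\<le>n. (S j - T j) * ffact (real k) j) = 0"
        using S T by (simp add: left_diff_distrib sum_subtractf)
      also have "(\<Sum>j\<le>n. (S j - T j) * ffact (real k) j)
          = (\<Sum>j\<in>{k}. (S j - T j) * ffact (real k) j)"
      proof (rule sum.mono_neutral_right)
        show "\<forall>j\<in>{..n} - {k}. (S j - T j) * ffact (real k) j = 0"
          using less.IH vanish by (metis DiffE diff_self linorder_neqE_nat
              mult_zero_left mult_zero_right singletonI)
      qed (use True in auto)
      finally show ?thesis by (auto simp: ffact_def)
    qed
  qed
  then show "S = T" by blast
qed

text \<open>In row \<open>Suc n\<close> the factor \<open>n - 1\<close> of the usual recurrence, which is indexed by the
  new row, becomes \<open>n\<close>.\<close>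

primrec deg_A_matrix :: "real \<Rightarrow> (nat \<Rightarrow> real) \<Rightarrow> nat \<Rightarrow> nat \<Rightarrow> real" where
  "deg_A_matrix lam b 0 = b"
| "deg_A_matrix lam b (Suc n) = (\<lambda>m.
     (real m + 1) * ((1 - real n * lam / (real m + 1)) * deg_A_matrix lam b n m
       - deg_A_matrix lam b n (m + 1)))"

end

theory Submission
  imports Defs
begin

text \<open>With \<open>(A f) m = (m + 1) * (f m - f (m + 1))\<close>, row \<open>n\<close> of the matrix arises from row \<open>0\<close> by
  applying \<open>A - i * lam\<close> for \<open>i < n\<close>. These operators commute, so passing from \<open>n\<close> to \<open>n + 1\<close>
  may instead change the initial sequence to \<open>A b - n * lam * b\<close>. After division by
  \<open>(-1) ^ k * fact k\<close>, the coefficients of \<open>b k\<close> in the first column then satisfy a recurrence in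
  \<open>n\<close> that follows from that of the degenerate Stirling numbers.\<close>

lemma deg_Stirling2_spec:
  shows deg_ffact_eq_sum_deg_Stirling2:
      "deg_ffact lam x n = (\<Sum>k\<le>n. deg_Stirling2 lam n k * ffact x k)"
    and deg_Stirling2_eq_0: "k > n \<Longrightarrow> deg_Stirling2 lam n k = 0"
  using theI'[OF ex1_deg_Stirling_row[of lam n]] unfolding deg_Stirling2_def by blast+

lemma deg_Stirling2_unique:
  assumes "\<And>x. deg_ffact lam x n = (\<Sum>k\<le>n. S k * ffact x k)" "\<And>k. k > n \<Longrightarrow> S k = 0"
  shows "deg_Stirling2 lam n = S"
  unfolding deg_Stirling2_def by (rule the1_equality[OF ex1_deg_Stirling_row]) (use assms in blast)

lemma deg_Stirling2_Suc:
  "deg_Stirling2 lam (Suc n) k = (case k of 0 \<Rightarrow> 0 | Suc j \<Rightarrow> deg_Stirling2 lam n j)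
     + (real k - real n * lam) * deg_Stirling2 lam n k"
proof -
  define S where "S = deg_Stirling2 lam n"
  define T where
    "T k = (case k of 0 \<Rightarrow> 0 | Suc j \<Rightarrow> S j) + (real k - real n * lam) * S k" for k
  have S0: "S k = 0" if "k > n" for k
    using that by (simp add: S_def deg_Stirling2_eq_0)
  have "deg_ffact lam x (Suc n) = (\<Sum>k\<le>Suc n. T k * ffact x k)" for x
  proof -
    have "deg_ffact lam x (Suc n) = (x - real n * lam) * (\<Sum>k\<le>n. S k * ffact x k)"
      using deg_ffact_eq_sum_deg_Stirling2[of lam x n]
      by (simp add: deg_ffact_def S_def mult.commute)
    \<comment> \<open>In the \<open>k\<close>-th term, split \<open>x - n * lam\<close> as
      \<open>(x - k) + (k - n * lam)\<close>; the factor \<open>x - k\<close> turns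
      \<open>ffact x k\<close> into \<open>ffact x (Suc k)\<close>.\<close>
    also have "\<dots> = (\<Sum>k\<le>n. S k * ffact x (Suc k) + (real k - real n * lam) * S k * ffact x k)"
      unfolding sum_distrib_left by (rule sum.cong) (auto simp: ffact_def algebra_simps)
    also have "\<dots> = (\<Sum>k\<le>n. S k * ffact x (Suc k))
        + (\<Sum>k\<le>Suc n. (real k - real n * lam) * S k * ffact x k)"
      by (simp add: sum.distrib S0)
    also have "(\<Sum>k\<le>n. S k * ffact x (Suc k))
        = (\<Sum>k\<le>Suc n. (case k of 0 \<Rightarrow> 0 | Suc j \<Rightarrow> S j) * ffact x k)"
      by (simp add: sum.atMost_Suc_shift del: sum.atMost_Suc)
    finally show ?thesis
      by (simp only: T_def sum.distrib distrib_right)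
  qed
  moreover have "T k = 0" if "k > Suc n" for k
    using that S0 by (auto simp: T_def split: nat.splits)
  ultimately have "deg_Stirling2 lam (Suc n) = T"
    by (rule deg_Stirling2_unique)
  then show ?thesis
    by (simp add: T_def S_def split: nat.split)
qed

definition A_step :: "real \<Rightarrow> (nat \<Rightarrow> real) \<Rightarrow> nat \<Rightarrow> real" where
  "A_step c f m = (real m + 1 - c) * f m - (real m + 1) * f (Suc m)"

lemma A_step_commute: "A_step c (A_step d f) = A_step d (A_step c f)"
  by (rule ext) (simp add: A_step_def algebra_simps)

lemma deg_A_matrix_Suc:
  "deg_A_matrix lam b (Suc n) = A_step (real n * lam) (deg_A_matrix lam b n)"
  by (rule ext) (simp add: A_step_def field_simps)

lemma deg_A_matrix_A_step:
  "deg_A_matrix lam (A_step c b) n = A_step c (deg_A_matrix lam b n)"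
proof (induction n)
  case (Suc n)
  then show ?case
    unfolding deg_A_matrix_Suc by (simp add: A_step_commute)
qed simp

text \<open>These are the coefficients of \<open>deg_ffact lam (x + 1) n\<close> in the basis
  \<open>ffact x k\<close>, because
  \<open>ffact (x + 1) k = ffact x k + k * ffact x (k - 1)\<close>. Only row \<open>n\<close>
  occurs, which makes the recurrence in \<open>n\<close> easy to derive.\<close>

definition A_coeff :: "real \<Rightarrow> nat \<Rightarrow> nat \<Rightarrow> real" where
  "A_coeff lam n k = deg_Stirling2 lam n k + (real k + 1) * deg_Stirling2 lam n (Suc k)"

text \<open>The Stirling recurrence at \<open>k + 1\<close> has the factor
  \<open>k + 1 - n * lam\<close>; the added term cancels its \<open>n * lam\<close>.\<close>

lemma A_coeff_altdef:
  "A_coeff lam n k =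
     deg_Stirling2 lam (n + 1) (k + 1) + real n * lam * deg_Stirling2 lam n (k + 1)"
  by (simp add: A_coeff_def deg_Stirling2_Suc algebra_simps)

text \<open>The factor reflects \<open>x + 1 - n * lam = (x - k) + (k + 1 - n * lam)\<close>. The
  Stirling recurrence at \<open>k\<close> and \<open>Suc k\<close> suffices to verify it.\<close>

lemma A_coeff_Suc:
  "A_coeff lam (Suc n) k = (case k of 0 \<Rightarrow> 0 | Suc j \<Rightarrow> A_coeff lam n j)
     + (real k + 1 - real n * lam) * A_coeff lam n k"
  by (simp add: A_coeff_def deg_Stirling2_Suc algebra_simps split: nat.splits)

lemma A_coeff_eq_0: "k > n \<Longrightarrow> A_coeff lam n k = 0"
  by (simp add: A_coeff_def deg_Stirling2_eq_0)

lemma deg_A_matrix_first_column: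
  "deg_A_matrix lam b n 0 = (\<Sum>k\<le>n. (-1) ^ k * fact k * A_coeff lam n k * b k)"
proof (induction n arbitrary: b)
  case 0
  have "deg_Stirling2 lam 0 0 = 1"
    using deg_ffact_eq_sum_deg_Stirling2[of lam 0 0] by (simp add: deg_ffact_def ffact_def)
  then show ?case
    by (simp add: A_coeff_def deg_Stirling2_eq_0)
next
  case (Suc n)
  let ?s = "\<lambda>k. (-1) ^ k * fact k :: real"
  let ?c = "A_coeff lam n"
  have "deg_A_matrix lam b (Suc n) 0 = (\<Sum>k\<le>n. ?s k * ?c k * A_step (real n * lam) b k)"
    \<comment> \<open>The last row step is moved onto \<open>b\<close>, so the induction hypothesis
      is needed for a changed sequence.\<close>
    unfolding deg_A_matrix_Suc deg_A_matrix_A_step[symmetric] by (rule Suc.IH)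
  \<comment> \<open>Since \<open>?s (Suc k) = - (k + 1) * ?s k\<close>, the factor of
    \<open>b (Suc k)\<close> in \<open>A_step\<close> is absorbed into the sign and
    factorial.\<close>
  also have "\<dots> = (\<Sum>k\<le>n. ?s k * ((real k + 1 - real n * lam) * ?c k) * b k)
      + (\<Sum>k\<le>n. ?s (Suc k) * ?c k * b (Suc k))"
    unfolding sum.distrib[symmetric] by (rule sum.cong) (simp_all add: A_step_def algebra_simps)
  \<comment> \<open>The new term at \<open>k = Suc n\<close> vanishes, so both sums can run up to
    \<open>Suc n\<close>.\<close>
  also have "(\<Sum>k\<le>n. ?s k * ((real k + 1 - real n * lam) * ?c k) * b k)
      = (\<Sum>k\<le>Suc n. ?s k * ((real k + 1 - real n * lam) * ?c k) * b k)"
    by (simp add: A_coeff_eq_0)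
  also have "(\<Sum>k\<le>n. ?s (Suc k) * ?c k * b (Suc k))
      = (\<Sum>k\<le>Suc n. ?s k * (case k of 0 \<Rightarrow> 0 | Suc j \<Rightarrow> ?c j) * b k)"
    by (simp add: sum.atMost_Suc_shift del: sum.atMost_Suc)
  finally show ?case
    by (simp only: A_coeff_Suc distrib_left distrib_right sum.distrib add.commute)
qed

theorem theorem3p1:
  fixes lam :: real and b :: "nat \<Rightarrow> real" and n :: nat
  assumes "lam \<noteq> 0"
  shows "deg_A_matrix lam b n 0 =
    (\<Sum>k=0..n. (-1) ^ k * fact k *
      (deg_Stirling2 lam (n + 1) (k + 1) + real n * lam * deg_Stirling2 lam n (k + 1)) *
      deg_A_matrix lam b 0 k)"
  unfolding A_coeff_altdef[symmetric]
  by (simp add: deg_A_matrix_first_column atMost_atLeast0)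

end
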